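(* Let $A,B>0$ be real numbers, let $N$ be either $\{1,2,\dots,m\}$ for some integer $m\ge 1$ or the set of all positive integers, and for each $n\in N$ let $w(n),l(n)>0$ be real numbers. Rectangles of sides $(w(n),l(n))$, $n\in N$, can perfectly pack a rectangle of sides $(A,B)$ if and only if there exist real numbers $x_n^-,x_n^+,y_n^-,y_n^+$ ($n\in N$) satisfying the system of polynomial equations $$\sum_{n\in N}\Big\{(x_n^+)^{S_1}-(x_n^-)^{S_1}\Big\}\Big\{(y_n^+)^{S_2}-(y_n^-)^{S_2}\Big\}=A^{S_1}B^{S_2}\qquad\text{for all integers } S_1,S_2\ge 1,$$ together with the constraints, for every $n\in N$, $$\Delta x_n+\Delta y_n=w(n)+l(n),\qquad \Delta x_n\,\Delta y_n=w(n)\,l(n),$$ where $\Delta x_n=x_n^+-x_n^-$ and $\Delta y_n=y_n^+-y_n^-$.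
   Context: The rectangle of sides $(A,B)$ (the box) is placed in the coordinate plane as $[0,A]\times[0,B]$, with its left-bottom corner at the origin. Each rectangle is placed with sides parallel to the coordinate axes, and may be placed in either of its two axis-parallel orientations (horizontal side $w(n)$ and vertical side $l(n)$, or vice versa); the $n$-th rectangle, once placed, is $[x_n^-,x_n^+]\times[y_n^-,y_n^+]$, with corners $(x_n^-,y_n^-),(x_n^+,y_n^-),(x_n^-,y_n^+),(x_n^+,y_n^+)$. The rectangles perfectly pack the box if all of them can be placed in this way so that every placed rectangle is contained in the box, distinct placed rectangles do not overlap (their interiors are pairwise disjoint), and together they cover the box up to a set of Lebesgue measure zero (equivalently, their areas sum to $AB$). When $N$ is infinite, the sums over $n\in N$ in the system are infinite series, and being a solution includes convergence of each of these series to the stated value. *)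

theory Defs
  imports "HOL-Analysis.Analysis"
begin

definition rect :: "real \<Rightarrow> real \<Rightarrow> real \<Rightarrow> real \<Rightarrow> (real \<times> real) set" where
  "rect xm xp ym yp = {xm..xp} \<times> {ym..yp}"

text \<open>The two disjuncts in the first conjunct are the two axis-parallel orientations.\<close>

definition perfect_packing ::
  "nat set \<Rightarrow> (nat \<Rightarrow> real) \<Rightarrow> (nat \<Rightarrow> real) \<Rightarrow> real \<Rightarrow> real \<Rightarrow>
   (nat \<Rightarrow> real) \<Rightarrow> (nat \<Rightarrow> real) \<Rightarrow> (nat \<Rightarrow> real) \<Rightarrow> (nat \<Rightarrow> real) \<Rightarrow> bool" where
  "perfect_packing N w l A B xm xp ym yp \<longleftrightarrow>
     (\<forall>n\<in>N. (xp n = xm n + w n \<and> yp n = ym n + l n) \<or>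
            (xp n = xm n + l n \<and> yp n = ym n + w n)) \<and>
     (\<forall>n\<in>N. rect (xm n) (xp n) (ym n) (yp n) \<subseteq> rect 0 A 0 B) \<and>
     (\<forall>n\<in>N. \<forall>k\<in>N. n \<noteq> k \<longrightarrow>
        interior (rect (xm n) (xp n) (ym n) (yp n)) \<inter>
        interior (rect (xm k) (xp k) (ym k) (yp k)) = {}) \<and>
     rect 0 A 0 B - (\<Union>n\<in>N. rect (xm n) (xp n) (ym n) (yp n)) \<in> null_sets lebesgue"

definition can_perfectly_pack ::
  "nat set \<Rightarrow> (nat \<Rightarrow> real) \<Rightarrow> (nat \<Rightarrow> real) \<Rightarrow> real \<Rightarrow> real \<Rightarrow> bool" where
  "can_perfectly_pack N w l A B \<longleftrightarrow>
     (\<exists>xm xp ym yp. perfect_packing N w l A B xm xp ym yp)"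

text \<open>A sum over an index set of naturals, read as a finite sum if the set is finite and
  otherwise as an ordinary, possibly only conditionally convergent series in the
  natural order of the indices; \<open>(has_sum)\<close> would demand unconditional convergence.\<close>

definition sums_over :: "nat set \<Rightarrow> (nat \<Rightarrow> real) \<Rightarrow> real \<Rightarrow> bool" where
  "sums_over N f s \<longleftrightarrow> (\<lambda>n. if n \<in> N then f n else 0) sums s"

lemma sums_over_finite: "finite N \<Longrightarrow> sums_over N f s \<longleftrightarrow> (\<Sum>n\<in>N. f n) = s"
  unfolding sums_over_def using sums_If_finite_set[of N f] sums_unique2 by blast

lemma sums_over_positive: "sums_over {1..} f s \<longleftrightarrow> (\<lambda>n. f (Suc n)) sums s"
  unfolding sums_over_def
  using sums_Suc_iff[of "\<lambda>n. if n \<in> {1..} then f n else 0" s] by simp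

end

theory Submission
  imports Defs
begin

text \<open>
  Up to the factor \<open>S\<^sub>1 S\<^sub>2\<close>, the left-hand side of an equation of the system is the sum over \<open>n\<close> of
  the integrals of \<open>x\<^bsup>S\<^sub>1 - 1\<^esup> y\<^bsup>S\<^sub>2 - 1\<^esup>\<close> over the rectangles \<open>R n\<close>, and the right-hand side is the
  integral of the same monomial over the box. So the system says that the multiplicity function
  \<open>D = \<Sum>n. indicator (R n)\<close> has the same moments as the indicator function of the box.
  The two constraints on \<open>\<Delta>x\<^sub>n\<close> and \<open>\<Delta>y\<^sub>n\<close> say that these are the roots \<open>w n\<close> and \<open>l n\<close> of one
  quadratic, in one order or the other: the choice of an orientation.

  Both sides of the equivalence are compared with the condition that \<open>D\<close> equals the indicator of
  the box almost everywhere (\<open>tiles_AE\<close>). Sides of rectangles are null sets and nonempty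
  open sets are not, which makes this equivalent to a perfect packing
  (\<open>perfect_packing_iff_tiles_AE\<close>). It implies the system by dominated convergence, as the
  partial sums of \<open>D\<close> lie between \<open>0\<close> and the indicator of the box (\<open>tiles_AE_moments\<close>).

  Conversely, the system has to determine \<open>D\<close>. A function is determined by its moments if it has
  bounded support, but the rectangles of a solution are not placed in a bounded region by
  hypothesis. The equations with odd exponents force them to be: in these all summands are
  nonnegative, so each is at most \<open>A\<^bsup>S\<^sub>1\<^esup> B\<^bsup>S\<^sub>2\<^esup>\<close>, and a rectangle that leaves \<open>[-A, A] \<times> [-B, B]\<close>
  would violate this for large exponents (\<open>rect_subset_if_moment_equations\<close>).
  Inside this compact region the first equation bounds the total area, the series may be integrated
  against any monomial term by term, and the difference \<open>h\<close> of \<open>D\<close> and the indicator of the box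
  is an integrable function orthogonal to all monomials. By the Stone--Weierstrass theorem \<open>h\<close> is
  orthogonal to all continuous functions, and therefore vanishes almost everywhere
  (\<open>AE_eq_0_if_orthogonal_to_monomials\<close>).
\<close>

section \<open>Integrable functions with vanishing moments\<close>

text \<open>The closed sets form an intersection-stable generator of the Borel sets, so a Dynkin argument
  extends the vanishing of the integrals to all Borel sets.\<close>

lemma AE_eq_0_if_integral_closed_eq_0:
  fixes h :: "'a::euclidean_space \<Rightarrow> real"
  assumes h: "integrable lborel h"
    and closed: "\<And>C. closed C \<Longrightarrow> (LINT x:C|lborel. h x) = 0"
  shows "AE x in lborel. h x = 0"
proof -
  have [measurable]: "h \<in> borel_measurable borel"
    using h by auto
  have borel_sigma: "sets borel = sigma_sets UNIV (Collect closed :: 'a set set)"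
    by (subst borel_eq_closed) (simp add: sets_measure_of)
  have int: "set_integrable lborel X h" if "X \<in> sets borel" for X
    using h that unfolding set_integrable_def
    by (intro integrable_mult_indicator) auto
  have stable: "Int_stable (Collect closed :: 'a set set)"
    and closed_Pow: "Collect closed \<subseteq> Pow (UNIV :: 'a set)"
    by (auto simp: Int_stable_def)
  have "(LINT x:X|lborel. h x) = 0" if "X \<in> sigma_sets UNIV (Collect closed)" for X
    using stable closed_Pow that
  proof (induction rule: sigma_sets_induct_disjoint)
    case (basic C)
    then show ?case by (simp add: closed)
  next
    case empty
    then show ?case by (simp add: set_lebesgue_integral_def)
  next
    case (compl X)
    then have X: "X \<in> sets borel"
      by (simp add: borel_sigma)
    have "(LINT x:UNIV|lborel. h x) = (LINT x:X|lborel. h x) + (LINT x:UNIV - X|lborel. h x)"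
      using set_integral_Un[of X "UNIV - X" lborel h] int X by auto
    then show ?case
      using compl closed[of UNIV] by simp
  next
    case (union F)
    then have "F i \<in> sets lborel" for i
      by (auto simp: borel_sigma)
    moreover have "set_integrable lborel (\<Union>i. F i) h"
      using calculation by (intro int) auto
    ultimately have "(LINT x:(\<Union>i. F i)|lborel. h x) = (\<Sum>i. LINT x:F i|lborel. h x)"
      using union by (intro lebesgue_integral_countable_add) (auto simp: disjoint_family_on_def)
    then show ?case
      using union by simp
  qed
  then show ?thesis
    using density_unique_real[OF h, of "\<lambda>x. 0"] borel_sigma
    by (simp add: set_lebesgue_integral_def)
qed

text \<open>Closed sets are reached from continuous functions: their indicators are pointwise limits of the
  bounded continuous functions \<open>x \<mapsto> (1 + infdist x C)\<^bsup>-k\<^esup>\<close>.\<close>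

lemma AE_eq_0_if_orthogonal_to_continuous:
  fixes h :: "'a::euclidean_space \<Rightarrow> real"
  assumes h: "integrable lborel h"
    and orth: "\<And>f. continuous_on UNIV f \<Longrightarrow> bounded (range f) \<Longrightarrow> (LINT x|lborel. f x * h x) = 0"
  shows "AE x in lborel. h x = 0"
proof (rule AE_eq_0_if_integral_closed_eq_0[OF h])
  fix C :: "'a set" assume "closed C"
  have [measurable]: "h \<in> borel_measurable borel" "C \<in> sets borel"
    using h \<open>closed C\<close> by auto
  show "(LINT x:C|lborel. h x) = 0"
  proof (cases "C = {}")
    case False
    define f where "f k x = (1 / (1 + infdist x C)) ^ k" for k x
    have cont: "continuous_on UNIV (f k)" for k
      unfolding f_def
      by (intro continuous_intros ballI) (metis add_nonneg_eq_0_iff infdist_nonneg zero_le_one zero_neq_one)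
    have [measurable]: "f k \<in> borel_measurable borel" for k
      using cont by (rule borel_measurable_continuous_onI)
    have f_bounds: "0 \<le> f k x" "f k x \<le> 1" for k x
      unfolding f_def using infdist_nonneg[of x C] by (auto intro!: power_le_one)
    have lim: "(\<lambda>k. f k x) \<longlonglongrightarrow> indicator C x" for x
    proof (cases "x \<in> C")
      case True
      then show ?thesis by (simp add: f_def)
    next
      assume "x \<notin> C"
      then have "infdist x C > 0"
        using \<open>closed C\<close> False by (metis infdist_nonneg in_closed_iff_infdist_zero order_le_less)
      then show ?thesis
        using \<open>x \<notin> C\<close> unfolding f_def by (auto intro!: LIMSEQ_power_zero simp: divide_less_eq_1)
    qed
    have "(\<lambda>k. LINT x|lborel. f k x * h x) \<longlonglongrightarrow> (LINT x|lborel. indicator C x * h x)"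
    proof (rule integral_dominated_convergence[where w="\<lambda>x. norm (h x)"])
      show "AE x in lborel. norm (f k x * h x) \<le> norm (h x)" for k
        using f_bounds by (auto simp: abs_mult intro!: mult_left_le_one_le)
      show "AE x in lborel. (\<lambda>k. f k x * h x) \<longlonglongrightarrow> indicator C x * h x"
        by (intro AE_I2 tendsto_mult lim tendsto_const)
    qed (use h in \<open>auto intro: integrable_norm\<close>)
    moreover have "(LINT x|lborel. f k x * h x) = 0" for k
      using f_bounds by (intro orth cont) (auto intro!: boundedI[where B=1])
    ultimately show ?thesis
      by (simp add: set_lebesgue_integral_def LIMSEQ_const_iff)
  qed (simp add: set_lebesgue_integral_def)
qed

lemma integrable_continuous_mult_compact_support:
  fixes h :: "'a::euclidean_space \<Rightarrow> real"
  assumes h: "integrable lborel h" and S: "compact S" "\<And>x. x \<notin> S \<Longrightarrow> h x = 0"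
    and f: "continuous_on UNIV f"
  shows "integrable lborel (\<lambda>x. f x * h x)"
proof -
  have "compact (f ` S)"
    using S f by (meson compact_continuous_image continuous_on_subset subset_UNIV)
  then obtain K where "\<And>x. x \<in> S \<Longrightarrow> norm (f x) \<le> K"
    by (metis bounded_iff compact_imp_bounded imageI)
  then have "norm (f x * h x) \<le> norm (K * h x)" for x
    using S(2)[of x] by (cases "x \<in> S") (force simp: abs_mult intro: mult_right_mono)+
  moreover have "(\<lambda>x. f x * h x) \<in> borel_measurable lborel"
    using h borel_measurable_continuous_onI[OF f] by (intro borel_measurable_times) auto
  ultimately show ?thesis
    by (intro Bochner_Integration.integrable_bound[OF integrable_mult_right[OF h, of K]]) auto
qed

text \<open>Compactness of the support is what brings in Stone--Weierstrass: on \<open>S\<close> a continuous \<open>f\<close> is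
  uniformly approximated by polynomials \<open>p\<close>, and \<open>\<integral>f h = \<integral>(f - p) h\<close> is then at most the
  approximation error times the norm of \<open>h\<close> in \<open>L\<^sup>1\<close>.\<close>

lemma AE_eq_0_if_orthogonal_to_polynomials:
  fixes h :: "'a::euclidean_space \<Rightarrow> real"
  assumes h: "integrable lborel h" and S: "compact S" "\<And>x. x \<notin> S \<Longrightarrow> h x = 0"
    and orth: "\<And>p. real_polynomial_function p \<Longrightarrow> (LINT x|lborel. p x * h x) = 0"
  shows "AE x in lborel. h x = 0"
proof (rule AE_eq_0_if_orthogonal_to_continuous[OF h])
  fix f :: "'a \<Rightarrow> real" assume f: "continuous_on UNIV f"
  define L where "L = (LINT x|lborel. norm (h x))"
  have "L \<ge> 0"
    by (simp add: L_def)
  have "\<bar>LINT x|lborel. f x * h x\<bar> \<le> e" if "e > 0" for e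
  proof -
    \<comment> \<open>The denominator is \<open>L + 1\<close> and not \<open>L\<close> because \<open>L = 0\<close> is possible.\<close>
    have "e / (L + 1) > 0"
      using \<open>L \<ge> 0\<close> that by simp
    then have "\<exists>p. polynomial_function p \<and> (\<forall>x\<in>S. norm (f x - p x) < e / (L + 1))"
      by (intro Stone_Weierstrass_polynomial_function S continuous_on_subset[OF f subset_UNIV])
    then obtain p where p: "polynomial_function p" "\<And>x. x \<in> S \<Longrightarrow> norm (f x - p x) < e / (L + 1)"
      by blast
    have cont_p: "continuous_on UNIV p"
      using p by (simp add: continuous_at_imp_continuous_on continuous_polymonial_function)
    have "(LINT x|lborel. f x * h x) = (LINT x|lborel. f x * h x) - (LINT x|lborel. p x * h x)"
      using orth p by (simp add: real_polynomial_function_eq)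
    also have "\<dots> = (LINT x|lborel. (f x - p x) * h x)"
      using integrable_continuous_mult_compact_support[OF h S f]
        integrable_continuous_mult_compact_support[OF h S cont_p]
      by (simp add: left_diff_distrib)
    also have "\<bar>\<dots>\<bar> \<le> (LINT x|lborel. norm ((f x - p x) * h x))"
      using integral_norm_bound[of lborel "\<lambda>x. (f x - p x) * h x"] by simp
    also have "\<dots> \<le> (LINT x|lborel. e / (L + 1) * norm (h x))"
    proof (rule integral_mono)
      show "integrable lborel (\<lambda>x. norm ((f x - p x) * h x))"
        using f cont_p
        by (intro integrable_norm integrable_continuous_mult_compact_support[OF h S] continuous_intros)
      show "norm ((f x - p x) * h x) \<le> e / (L + 1) * norm (h x)" for x
      proof (cases "x \<in> S")
        case True
        then show ?thesis
          unfolding norm_mult by (intro mult_right_mono less_imp_le p(2) norm_ge_zero)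
      qed (simp add: S(2))
    qed (use h in auto)
    also have "\<dots> = e / (L + 1) * L"
      by (simp add: L_def)
    also have "\<dots> \<le> e"
      using \<open>L \<ge> 0\<close> that by (simp add: field_simps)
    finally show ?thesis .
  qed
  then have "\<bar>LINT x|lborel. f x * h x\<bar> \<le> 0"
    by (rule field_le_epsilon[of _ 0, simplified])
  then show "(LINT x|lborel. f x * h x) = 0"
    by simp
qed

text \<open>The continuous \<open>q\<close> for which \<open>q h\<close> is orthogonal to all monomials form a set \<open>V\<close> that contains
  \<open>1\<close>. Induction on a polynomial \<open>p\<close> shows that multiplication by \<open>p\<close> maps \<open>V\<close> to itself. This form
  of the claim composes: the induction hypotheses for two factors, applied one after the other, give
  it for their product. Hence \<open>p = p \<cdot> 1\<close> lies in \<open>V\<close>.\<close>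

lemma AE_eq_0_if_orthogonal_to_monomials:
  fixes h :: "real \<times> real \<Rightarrow> real"
  assumes h: "integrable lborel h" and S: "compact S" "\<And>x. x \<notin> S \<Longrightarrow> h x = 0"
    and orth: "\<And>i j. (LINT z|lborel. fst z ^ i * snd z ^ j * h z) = 0"
  shows "AE z in lborel. h z = 0"
proof (rule AE_eq_0_if_orthogonal_to_polynomials[OF h S])
  define V where "V = {q. continuous_on UNIV q \<and>
    (\<forall>i j. (LINT z|lborel. fst z ^ i * snd z ^ j * q z * h z) = 0)}"
  fix p :: "real \<times> real \<Rightarrow> real" assume "real_polynomial_function p"
  then have "(\<lambda>z. p z * q z) \<in> V" if "q \<in> V" for q
    using that
  proof (induction arbitrary: q rule: real_polynomial_function.induct)
    case (linear f)
    define a b where "a = f (1, 0)" and "b = f (0, 1)"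
    have f_eq: "f z = a * fst z + b * snd z" for z
    proof -
      have "f z = f (fst z *\<^sub>R (1, 0) + snd z *\<^sub>R (0, 1))"
        by simp
      also have "\<dots> = fst z * f (1, 0) + snd z * f (0, 1)"
        using linear_add[OF bounded_linear.linear[OF linear(1)]]
          linear_scale[OF bounded_linear.linear[OF linear(1)]]
        by (metis real_scaleR_def)
      finally show ?thesis
        by (simp add: a_def b_def)
    qed
    have q: "continuous_on UNIV q" "(LINT z|lborel. fst z ^ i * snd z ^ j * q z * h z) = 0" for i j
      using linear(2) by (auto simp: V_def)
    have int: "integrable lborel (\<lambda>z. fst z ^ i * snd z ^ j * q z * h z)" for i j
      using q(1) by (intro integrable_continuous_mult_compact_support[OF h S] continuous_intros)
    have "(LINT z|lborel. fst z ^ i * snd z ^ j * (f z * q z) * h z) = 0" for i j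
    proof -
      have "(LINT z|lborel. fst z ^ i * snd z ^ j * (f z * q z) * h z) =
        (LINT z|lborel. a * (fst z ^ Suc i * snd z ^ j * q z * h z) +
           b * (fst z ^ i * snd z ^ Suc j * q z * h z))"
        by (intro Bochner_Integration.integral_cong refl) (simp add: f_eq algebra_simps)
      also have "\<dots> = a * (LINT z|lborel. fst z ^ Suc i * snd z ^ j * q z * h z) +
          b * (LINT z|lborel. fst z ^ i * snd z ^ Suc j * q z * h z)"
        using int by (simp del: power_Suc)
      also have "\<dots> = 0"
        by (simp only: q mult_zero_right add_0_right)
      finally show ?thesis .
    qed
    moreover have "continuous_on UNIV (\<lambda>z. f z * q z)"
      by (intro continuous_intros linear_continuous_on linear(1) q(1))
    ultimately show ?case
      by (simp add: V_def)
  next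
    case (const c)
    have "(\<lambda>z. fst z ^ i * snd z ^ j * (c * q z) * h z) =
        (\<lambda>z. c * (fst z ^ i * snd z ^ j * q z * h z))" for i j
      by auto
    then show ?case
      using const by (auto simp: V_def intro!: continuous_intros)
  next
    case (add f g)
    have "(\<lambda>z. f z * q z) \<in> V" "(\<lambda>z. g z * q z) \<in> V"
      using add by auto
    moreover have "integrable lborel (\<lambda>z. fst z ^ i * snd z ^ j * k z * h z)" if "k \<in> V" for i j k
      using that unfolding V_def
      by (intro integrable_continuous_mult_compact_support[OF h S] continuous_intros) auto
    ultimately show ?case
      unfolding V_def by (auto simp: distrib_left distrib_right intro!: continuous_intros)
  next
    case (mult f g)
    then have "(\<lambda>z. f z * (g z * q z)) \<in> V"
      by blast
    then show ?case
      by (simp add: mult.assoc)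
  qed
  moreover have "(\<lambda>z. 1) \<in> V"
    using orth by (simp add: V_def)
  ultimately have "(\<lambda>z. p z * 1) \<in> V"
    by blast
  then have "(LINT z|lborel. fst z ^ 0 * snd z ^ 0 * (p z * 1) * h z) = 0"
    unfolding V_def by blast
  then show "(LINT z|lborel. p z * h z) = 0"
    by simp
qed

section \<open>Rectangles and their moments\<close>

lemma rect_eq_cbox: "rect a b c d = cbox (a, c) (b, d)"
  by (simp add: rect_def cbox_Pair_eq)

lemma compact_rect: "compact (rect a b c d)"
  by (simp add: rect_eq_cbox)

lemma sets_rect [measurable]: "rect a b c d \<in> sets borel"
  by (simp add: rect_eq_cbox)

lemma closure_interior_rect:
  assumes "a < b" "c < d"
  shows "closure (interior (rect a b c d)) = rect a b c d"
  using assms by (simp add: rect_def interior_Times closure_Times)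

lemma open_eq_empty_if_AE_notin:
  fixes U :: "'a::euclidean_space set"
  assumes "open U" "AE x in lborel. x \<notin> U"
  shows "U = {}"
proof -
  have "U \<in> null_sets lborel"
    using assms by (subst AE_iff_null_sets) auto
  then show ?thesis
    using open_not_negligible[OF assms(1)]
    by (auto simp: negligible_iff_null_sets null_sets_completionI)
qed

lemma integrable_monomial_rect:
  "integrable lborel (\<lambda>z. fst z ^ i * snd z ^ j * indicat_real (rect a b c d) z)"
  using borel_integrable_compact[OF compact_rect, of a b c d "\<lambda>z. fst z ^ i * snd z ^ j"]
  by (simp add: mult.commute continuous_intros)

lemma integral_monomial_rect:
  assumes "a \<le> b" "c \<le> d"
  shows "(LINT z|lborel. fst z ^ i * snd z ^ j * indicat_real (rect a b c d) z) =
    (b ^ Suc i - a ^ Suc i) * (d ^ Suc j - c ^ Suc j) / (real (Suc i) * real (Suc j))"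
proof -
  have "(LINT z|lborel. fst z ^ i * snd z ^ j * indicat_real (rect a b c d) z) =
    (LINT x|lborel. LINT y|lborel. x ^ i * y ^ j * indicat_real (rect a b c d) (x, y))"
    using lborel_pair.integral_fst'[of "\<lambda>z. fst z ^ i * snd z ^ j * indicat_real (rect a b c d) z"]
      integrable_monomial_rect[of i j a b c d]
    by (simp add: lborel_prod)
  also have "\<dots> = (LINT x|lborel. x ^ i * indicat_real {a..b} x * (LINT y|lborel. y ^ j * indicat_real {c..d} y))"
    by (simp add: rect_def indicator_times mult_ac flip: integral_mult_right_zero)
  also have "\<dots> = (LINT x|lborel. x ^ i * indicat_real {a..b} x) * (LINT y|lborel. y ^ j * indicat_real {c..d} y)"
    by (rule integral_mult_left_zero)
  also have "\<dots> = (b ^ Suc i - a ^ Suc i) * (d ^ Suc j - c ^ Suc j) / (real (Suc i) * real (Suc j))"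
    using assms by (simp only: integral_power times_divide_times_eq)
  finally show ?thesis .
qed

section \<open>Perfect packings as tilings almost everywhere\<close>

text \<open>Asking for a convergent sum of indicators, and not for disjointness and covering, makes the
  condition linear in the rectangles, so that it can be integrated.\<close>

definition tiles_AE ::
  "nat set \<Rightarrow> (nat \<Rightarrow> (real \<times> real) set) \<Rightarrow> (real \<times> real) set \<Rightarrow> bool" where
  "tiles_AE N R Q \<longleftrightarrow>
     (AE z in lborel. sums_over N (\<lambda>n. indicat_real (R n) z) (indicat_real Q z))"

text \<open>The indicators are nonnegative, so every partial sum of the series is dominated by its limit
  \<open>indicator Q\<close>, and dominated convergence applies.\<close>

lemma tiles_AE_moments:
  assumes tiles: "tiles_AE N R Q"
    and [measurable]: "\<And>n. R n \<in> sets borel" "Q \<in> sets borel"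
    and f: "integrable lborel (\<lambda>z. f z * indicat_real Q z)"
    and [measurable]: "f \<in> borel_measurable borel"
  shows "sums_over N (\<lambda>n. LINT z|lborel. f z * indicat_real (R n) z)
    (LINT z|lborel. f z * indicat_real Q z)"
proof -
  define r where "r n z = (if n \<in> N then indicat_real (R n) z else 0)" for n z
  have AE: "AE z in lborel. (\<lambda>n. r n z) sums indicat_real Q z"
    using tiles by (simp add: tiles_AE_def sums_over_def r_def)
  have r_nonneg: "0 \<le> r n z" for n z
    by (simp add: r_def)
  have [measurable]: "r n \<in> borel_measurable borel" for n
    unfolding r_def by measurable
  have bound: "AE z in lborel. \<forall>m. norm (f z * sum (\<lambda>n. r n z) {..<m}) \<le> norm (f z * indicat_real Q z)"
    using AE
  proof eventually_elim
    case (elim z)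
    have "sum (\<lambda>n. r n z) {..<m} \<le> indicat_real Q z" for m
      using elim r_nonneg by (metis sum_le_suminf finite_lessThan sums_iff)
    then show ?case
      by (auto simp: abs_mult sum_nonneg r_nonneg intro!: mult_left_mono)
  qed
  have "(\<lambda>m. LINT z|lborel. f z * sum (\<lambda>n. r n z) {..<m}) \<longlonglongrightarrow> (LINT z|lborel. f z * indicat_real Q z)"
  proof (rule integral_dominated_convergence[OF _ _ integrable_norm[OF f]])
    show "AE z in lborel. (\<lambda>m. f z * sum (\<lambda>n. r n z) {..<m}) \<longlonglongrightarrow> f z * indicat_real Q z"
      using AE by eventually_elim (auto simp: sums_def intro!: tendsto_mult)
    show "AE z in lborel. norm (f z * sum (\<lambda>n. r n z) {..<m}) \<le> norm (f z * indicat_real Q z)" for m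
      using bound by eventually_elim blast
  qed measurable
  moreover have "integrable lborel (\<lambda>z. f z * r n z)" for n
  proof (rule Bochner_Integration.integrable_bound[OF f])
    show "AE z in lborel. norm (f z * r n z) \<le> norm (f z * indicat_real Q z)"
      using AE
    proof eventually_elim
      case (elim z)
      have "r n z \<le> indicat_real Q z"
        using elim r_nonneg sum_le_suminf[of "\<lambda>n. r n z" "{n}"] by (auto simp: sums_iff)
      then show ?case
        by (auto simp: abs_mult r_nonneg intro!: mult_left_mono)
    qed
  qed measurable
  then have "(LINT z|lborel. f z * sum (\<lambda>n. r n z) {..<m}) =
      (\<Sum>n<m. LINT z|lborel. f z * r n z)" for m
    by (simp add: sum_distrib_left)
  moreover have "(LINT z|lborel. f z * r n z) =
      (if n \<in> N then LINT z|lborel. f z * indicat_real (R n) z else 0)" for n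
    by (simp add: r_def)
  ultimately show ?thesis
    by (simp add: sums_over_def sums_def)
qed

text \<open>From left to right, a point that lies on no side of a rectangle and is not one of the uncovered
  points is interior to exactly one rectangle if it is in the box, and in no rectangle otherwise.
  From right to left, the points of \<open>interior (R n)\<close> outside the box and the points of
  \<open>interior (R n) \<inter> interior (R k)\<close> form open sets on which the sum of the indicators is too large;
  these sets are null and therefore empty.\<close>

lemma perfect_packing_iff_tiles_AE:
  assumes w: "\<And>n. n \<in> N \<Longrightarrow> w n > 0" and l: "\<And>n. n \<in> N \<Longrightarrow> l n > 0"
    and orient: "\<And>n. n \<in> N \<Longrightarrow> (xp n = xm n + w n \<and> yp n = ym n + l n) \<or>
            (xp n = xm n + l n \<and> yp n = ym n + w n)"
  shows "perfect_packing N w l A B xm xp ym yp \<longleftrightarrow>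
    tiles_AE N (\<lambda>n. rect (xm n) (xp n) (ym n) (yp n)) (rect 0 A 0 B)"
proof -
  define R where "R n = rect (xm n) (xp n) (ym n) (yp n)" for n
  define Q where "Q = rect 0 A 0 B"
  define U where "U = (\<Union>n\<in>N. R n)"
  define r where "r n z = (if n \<in> N then indicat_real (R n) z else 0)" for n z
  have r_nonneg: "0 \<le> r n z" for n z
    by (simp add: r_def)
  have sides: "xm n < xp n" "ym n < yp n" if "n \<in> N" for n
    using orient[OF that] w[OF that] l[OF that] by auto
  have [measurable]: "R n \<in> sets borel" "Q \<in> sets borel" for n
    by (simp_all add: R_def Q_def sets_rect)
  have [measurable]: "U \<in> sets borel"
    unfolding U_def by (intro sets.countable_UN') auto
  have uncovered: "Q - U \<in> null_sets lebesgue \<longleftrightarrow> (AE z in lborel. z \<notin> Q - U)"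
    using AE_iff_null_sets[of "Q - U" lborel] by (simp add: null_sets_completion_iff)
  have "perfect_packing N w l A B xm xp ym yp \<longleftrightarrow>
    (\<forall>n\<in>N. R n \<subseteq> Q) \<and>
    (\<forall>n\<in>N. \<forall>k\<in>N. n \<noteq> k \<longrightarrow> interior (R n) \<inter> interior (R k) = {}) \<and>
    (AE z in lborel. z \<notin> Q - U)"
    using orient uncovered by (simp add: perfect_packing_def R_def Q_def U_def)
  also have "\<dots> \<longleftrightarrow> (AE z in lborel. (\<lambda>n. r n z) sums indicat_real Q z)" (is "?pack \<longleftrightarrow> ?tiles")
  proof
    assume ?pack
    then have sub: "\<And>n. n \<in> N \<Longrightarrow> R n \<subseteq> Q"
      and disj: "\<And>n k. n \<in> N \<Longrightarrow> k \<in> N \<Longrightarrow> n \<noteq> k \<Longrightarrow> interior (R n) \<inter> interior (R k) = {}"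
      and cover: "AE z in lborel. z \<notin> Q - U"
      by auto
    have "AE z in lborel. z \<notin> frontier (R n)" for n
    proof -
      have "negligible (frontier (R n))"
        by (simp add: negligible_convex_frontier R_def rect_eq_cbox)
      then have "frontier (R n) \<in> null_sets lborel"
        by (simp add: negligible_iff_null_sets null_sets_completion_iff)
      then show ?thesis
        by (rule AE_not_in)
    qed
    then have "AE z in lborel. \<forall>n. z \<notin> frontier (R n)"
      by (simp add: AE_all_countable)
    then show ?tiles
      using cover
    proof eventually_elim
      case (elim z)
      show ?case
      proof (cases "z \<in> Q")
        case False
        then have "r n z = 0" for n
          using sub[of n] False by (auto simp: r_def indicator_def)
        then show ?thesis
          using False by simp
      next
        case True
        then obtain n where n: "n \<in> N" "z \<in> R n"
          using elim by (auto simp: U_def)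
        have int: "z \<in> interior (R k)" if "z \<in> R k" for k
          using that elim closure_subset[of "R k"] by (auto simp: frontier_def)
        have "r k z = (if k = n then 1 else 0)" for k
          using n int disj[of n k] by (auto simp: r_def indicator_def)
        then show ?thesis
          using True sums_single[of n "\<lambda>_. 1::real"] by simp
      qed
    qed
  next
    assume tiles: ?tiles
    have partial: "AE z in lborel. \<forall>I. finite I \<longrightarrow> (\<Sum>n\<in>I. r n z) \<le> indicat_real Q z"
      using tiles
    proof eventually_elim
      case (elim z)
      then show ?case
        using r_nonneg by (metis sum_le_suminf sums_iff)
    qed
    have "R n \<subseteq> Q" if n: "n \<in> N" for n
    proof -
      have "AE z in lborel. z \<notin> interior (R n) - Q"
        using partial
      proof eventually_elim
        case (elim z)
        have "r n z \<le> indicat_real Q z"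
          using spec[OF elim, of "{n}"] by simp
        then show ?case
          using n interior_subset[of "R n"] by (auto simp: r_def indicator_def split: if_splits)
      qed
      moreover have "open (interior (R n) - Q)"
        unfolding Q_def rect_eq_cbox by (intro open_Diff open_interior closed_cbox)
      ultimately have "interior (R n) \<subseteq> Q"
        using open_eq_empty_if_AE_notin by blast
      then have "closure (interior (R n)) \<subseteq> Q"
        unfolding Q_def rect_eq_cbox by (intro closure_minimal closed_cbox)
      then show ?thesis
        using sides[OF n] by (simp add: R_def closure_interior_rect)
    qed
    moreover have "interior (R n) \<inter> interior (R k) = {}" if nk: "n \<in> N" "k \<in> N" "n \<noteq> k" for n k
    proof (rule open_eq_empty_if_AE_notin)
      show "AE z in lborel. z \<notin> interior (R n) \<inter> interior (R k)"
        using partial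
      proof eventually_elim
        case (elim z)
        have "r n z + r k z \<le> indicat_real Q z"
          using spec[OF elim, of "{n, k}"] nk by simp
        also have "\<dots> \<le> 1"
          by simp
        finally have "r n z + r k z \<le> 1" .
        then have "z \<notin> R n \<or> z \<notin> R k"
          using nk by (auto simp: r_def)
        then show ?case
          using interior_subset by blast
      qed
    qed (simp add: open_Int)
    moreover have "AE z in lborel. z \<notin> Q - U"
      using tiles
    proof eventually_elim
      case (elim z)
      show ?case
      proof
        assume z: "z \<in> Q - U"
        then have "r n z = 0" for n
          by (auto simp: r_def U_def)
        then show False
          using elim z sums_unique2[OF sums_zero] by fastforce
      qed
    qed
    ultimately show ?pack
      by blast
  qed
  finally show ?thesis
    unfolding tiles_AE_def sums_over_def r_def R_def Q_def .
qed

section \<open>The equations confine the rectangles\<close>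

text \<open>If \<open>b > A\<close>, then for \<open>c = max a A\<close> and \<open>m = 2 k + 1\<close> the difference
  \<open>b\<^sup>m - a\<^sup>m \<ge> b\<^sup>m - c\<^sup>m\<close> is at least \<open>m A\<^bsup>m - 1\<^esup> (b - c)\<close>, by the factorization of \<open>b\<^sup>m - c\<^sup>m\<close>.
  The factor \<open>m\<close> exceeds every bound. The exponent is odd because \<open>a\<close> may be negative:
  odd powers are monotone on the whole line.\<close>

lemma upper_end_le_if_odd_powers_bounded:
  fixes a b A C d :: real
  assumes "a < b" "A > 0" "d > 0"
    and bound: "\<And>k. (b ^ (2 * k + 1) - a ^ (2 * k + 1)) * d \<le> A ^ (2 * k + 1) * C"
  shows "b \<le> A"
proof (rule ccontr)
  assume "\<not> b \<le> A"
  define c where "c = max a A"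
  have c: "c < b" "A \<le> c" "a \<le> c"
    using assms \<open>\<not> b \<le> A\<close> by (auto simp: c_def)
  have "real (2 * k + 1) * ((b - c) * d) \<le> A * C" for k
  proof -
    have "real (2 * k + 1) * A ^ (2 * k) * (b - c) \<le> (\<Sum>i<2 * k + 1. b ^ i * c ^ (2 * k - i)) * (b - c)"
    proof (rule mult_right_mono)
      have "real (2 * k + 1) * A ^ (2 * k) = (\<Sum>i<2 * k + 1. A ^ i * A ^ (2 * k - i))"
        by (simp flip: power_add)
      also have "\<dots> \<le> (\<Sum>i<2 * k + 1. b ^ i * c ^ (2 * k - i))"
        using c \<open>A > 0\<close> by (intro sum_mono mult_mono power_mono) auto
      finally show "real (2 * k + 1) * A ^ (2 * k) \<le> (\<Sum>i<2 * k + 1. b ^ i * c ^ (2 * k - i))" .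
    qed (use c in simp)
    also have "\<dots> = b ^ (2 * k + 1) - c ^ (2 * k + 1)"
      using power_diff_sumr2[of b "2 * k + 1" c] by (simp add: mult.commute)
    also have "\<dots> \<le> b ^ (2 * k + 1) - a ^ (2 * k + 1)"
      using c(3) by (intro diff_left_mono power_mono_odd) auto
    finally have "real (2 * k + 1) * A ^ (2 * k) * (b - c) * d \<le> A ^ (2 * k + 1) * C"
      using bound[of k] \<open>d > 0\<close> by (meson mult_right_mono less_imp_le order_trans)
    then have "A ^ (2 * k) * (real (2 * k + 1) * ((b - c) * d)) \<le> A ^ (2 * k) * (A * C)"
      by (simp add: mult_ac)
    then show ?thesis
      using \<open>A > 0\<close> by (subst (asm) mult_le_cancel_left_pos) auto
  qed
  moreover obtain k where "A * C < real k * ((b - c) * d)"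
    using reals_Archimedean3[of "(b - c) * d"] c \<open>d > 0\<close> by auto
  moreover have "real k * ((b - c) * d) \<le> real (2 * k + 1) * ((b - c) * d)"
    using c \<open>d > 0\<close> by (intro mult_right_mono) auto
  ultimately show False
    by (meson not_le order_trans)
qed

text \<open>The hypothesis on \<open>[a, b]\<close> is inherited by \<open>[-b, -a]\<close>, since the powers are odd; the bound for
  upper ends therefore also gives the one for lower ends.\<close>

lemma interval_subset_if_odd_powers_bounded:
  fixes a b A C d :: real
  assumes "a < b" "A > 0" "d > 0"
    and bound: "\<And>k. (b ^ (2 * k + 1) - a ^ (2 * k + 1)) * d \<le> A ^ (2 * k + 1) * C"
  shows "{a..b} \<subseteq> {-A..A}"
proof -
  have "b \<le> A"
    by (rule upper_end_le_if_odd_powers_bounded[OF assms])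
  moreover have "- a \<le> A"
    using assms by (intro upper_end_le_if_odd_powers_bounded[of "- b" "- a" A d C])
      (simp_all add: power_minus_odd)
  ultimately show ?thesis
    by auto
qed

lemma sums_over_term_le:
  assumes "sums_over N f s" "n \<in> N" "\<And>k. k \<in> N \<Longrightarrow> f k \<ge> 0"
  shows "f n \<le> s"
  using assms sum_le_suminf[of "\<lambda>n. if n \<in> N then f n else 0" "{n}"]
  by (auto simp: sums_over_def sums_iff)

text \<open>For odd exponents no summand is negative, so each is bounded by the value of the sum. One exponent
  is kept at \<open>1\<close> while the other grows.\<close>

lemma rect_subset_if_moment_equations:
  fixes A B :: real
  assumes "A > 0" "B > 0"
    and sides: "\<And>n. n \<in> N \<Longrightarrow> xm n < xp n" "\<And>n. n \<in> N \<Longrightarrow> ym n < yp n"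
    and eqs: "\<And>s t. s \<ge> 1 \<Longrightarrow> t \<ge> 1 \<Longrightarrow>
      sums_over N (\<lambda>n. (xp n ^ s - xm n ^ s) * (yp n ^ t - ym n ^ t)) (A ^ s * B ^ t)"
    and n: "n \<in> N"
  shows "rect (xm n) (xp n) (ym n) (yp n) \<subseteq> rect (- A) A (- B) B"
proof -
  have le: "(xp n ^ s - xm n ^ s) * (yp n ^ t - ym n ^ t) \<le> A ^ s * B ^ t"
    if "odd s" "odd t" for s t
  proof (rule sums_over_term_le[OF eqs n])
    show "(xp k ^ s - xm k ^ s) * (yp k ^ t - ym k ^ t) \<ge> 0" if "k \<in> N" for k
      using sides[OF that] \<open>odd s\<close> \<open>odd t\<close>
      by (intro mult_nonneg_nonneg) (simp_all add: power_mono_odd)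
  qed (use that in \<open>auto simp: Suc_le_eq odd_pos\<close>)
  have "{xm n..xp n} \<subseteq> {-A..A}"
    using sides[OF n] \<open>A > 0\<close> le[of "2 * _ + 1" 1]
    by (intro interval_subset_if_odd_powers_bounded[where d="yp n - ym n" and C=B]) auto
  moreover have "{ym n..yp n} \<subseteq> {-B..B}"
    using sides[OF n] \<open>B > 0\<close> le[of 1 "2 * _ + 1"]
    by (intro interval_subset_if_odd_powers_bounded[where d="xp n - xm n" and C=A])
      (auto simp: mult.commute)
  ultimately show ?thesis
    unfolding rect_def by (rule Sigma_mono)
qed

section \<open>From the equations to a tiling\<close>

lemma AE_summable_if_integrals_summable:
  fixes r :: "nat \<Rightarrow> 'a \<Rightarrow> real"
  assumes int: "\<And>n. integrable M (r n)" and nonneg: "\<And>n x. 0 \<le> r n x"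
    and sum: "summable (\<lambda>n. LINT x|M. r n x)"
  shows "AE x in M. summable (\<lambda>n. r n x)"
proof -
  have [measurable]: "r n \<in> borel_measurable M" for n
    using int by auto
  have "(\<integral>\<^sup>+x. (\<Sum>n. ennreal (r n x)) \<partial>M) = (\<Sum>n. ennreal (LINT x|M. r n x))"
    using int nonneg by (simp add: nn_integral_suminf nn_integral_eq_integral)
  also have "\<dots> \<noteq> \<infinity>"
    using sum nonneg by (simp add: ennreal_suminf_neq_top)
  finally have "AE x in M. (\<Sum>n. ennreal (r n x)) \<noteq> \<infinity>"
    by (intro nn_integral_PInf_AE) auto
  then show ?thesis
    by eventually_elim (use nonneg in \<open>auto intro: summable_suminf_not_top\<close>)
qed

text \<open>The equation with \<open>i = j = 0\<close> makes the total area of the rectangles finite, so the multiplicity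
  function \<open>D\<close> is finite almost everywhere and integrable. This also dominates the series for all
  other monomials, which are bounded on \<open>K\<close>: although their convergence is assumed only as ordinary
  series, they converge absolutely and may be integrated term by term.\<close>

lemma tiles_AE_if_monomial_integrals:
  assumes R [measurable]: "\<And>n. R n \<in> sets borel" and Q [measurable]: "Q \<in> sets borel"
    and K: "compact K" "\<And>n. n \<in> N \<Longrightarrow> R n \<subseteq> K" "Q \<subseteq> K"
    and moments: "\<And>i j. sums_over N (\<lambda>n. LINT z|lborel. fst z ^ i * snd z ^ j * indicat_real (R n) z)
      (LINT z|lborel. fst z ^ i * snd z ^ j * indicat_real Q z)"
  shows "tiles_AE N R Q"
proof -
  define r where "r n z = (if n \<in> N then indicat_real (R n) z else 0)" for n z
  define D where "D z = (\<Sum>n. r n z)" for z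
  define h where "h z = D z - indicat_real Q z" for z
  have r_nonneg: "0 \<le> r n z" for n z
    by (simp add: r_def)
  have [measurable]: "r n \<in> borel_measurable borel" for n
    unfolding r_def by measurable
  have r_outside: "r n z = 0" if "z \<notin> K" for n z
    using K(2)[of n] that by (auto simp: r_def indicator_def)
  have int_ind: "integrable lborel (indicat_real X)" if "X \<in> sets borel" "X \<subseteq> K" for X
  proof -
    have "emeasure lborel X < \<infinity>"
      using emeasure_mono[OF that(2), of lborel] emeasure_compact_finite[OF K(1)] K(1)
      by (simp add: borel_compact)
    then show ?thesis
      using that by (simp add: integrable_indicator_iff)
  qed
  have int_r: "integrable lborel (r n)" for n
    using int_ind[OF R K(2), of n] unfolding r_def by (cases "n \<in> N") simp_all
  have r_moments: "(\<lambda>n. LINT z|lborel. fst z ^ i * snd z ^ j * r n z) sums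
      (LINT z|lborel. fst z ^ i * snd z ^ j * indicat_real Q z)" for i j
  proof -
    have "(\<lambda>n. LINT z|lborel. fst z ^ i * snd z ^ j * r n z) =
        (\<lambda>n. if n \<in> N then LINT z|lborel. fst z ^ i * snd z ^ j * indicat_real (R n) z else 0)"
      by (auto simp: r_def)
    then show ?thesis
      using moments[of i j] by (simp only: sums_over_def)
  qed
  have area: "summable (\<lambda>n. LINT z|lborel. r n z)"
    using r_moments[of 0 0] by (auto simp: sums_iff)
  have summable: "AE z in lborel. summable (\<lambda>n. r n z)"
    by (rule AE_summable_if_integrals_summable[OF int_r r_nonneg area])
  have int_D: "integrable lborel D"
    unfolding D_def
    by (rule integrable_suminf) (use int_r summable area r_nonneg in auto)
  have int_Q: "integrable lborel (indicat_real Q)"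
    using int_ind[OF Q K(3)] .
  have D_moments: "(LINT z|lborel. fst z ^ i * snd z ^ j * D z) =
      (LINT z|lborel. fst z ^ i * snd z ^ j * indicat_real Q z)" for i j
  proof -
    define f where "f z = fst z ^ i * snd z ^ j" for z :: "real \<times> real"
    have f: "continuous_on UNIV f"
      unfolding f_def by (intro continuous_intros)
    then have [measurable]: "f \<in> borel_measurable borel"
      by (rule borel_measurable_continuous_onI)
    have "compact (f ` K)"
      using K(1) f by (meson compact_continuous_image continuous_on_subset subset_UNIV)
    then obtain c where c: "\<And>z. z \<in> K \<Longrightarrow> \<bar>f z\<bar> \<le> c"
      by (metis bounded_iff compact_imp_bounded imageI real_norm_def)
    have bound: "norm (f z * r n z) \<le> c * r n z" for n z
      using c[of z] r_outside[of z n] r_nonneg[of n z]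
      by (cases "z \<in> K") (auto simp: abs_mult intro: mult_right_mono)
    have int: "integrable lborel (\<lambda>z. f z * r n z)" for n
      using r_outside f by (intro integrable_continuous_mult_compact_support[OF int_r K(1)])
    have "(\<lambda>n. LINT z|lborel. f z * r n z) sums (LINT z|lborel. (\<Sum>n. f z * r n z))"
    proof (rule sums_integral[OF int])
      show "AE z in lborel. summable (\<lambda>n. norm (f z * r n z))"
        using summable
      proof eventually_elim
        case (elim z)
        then show ?case
          by (rule summable_comparison_test'[OF summable_mult[of _ c]]) (use bound in auto)
      qed
      have "norm (LINT z|lborel. norm (f z * r n z)) \<le> c * (LINT z|lborel. r n z)" for n
      proof -
        have "(LINT z|lborel. norm (f z * r n z)) \<le> (LINT z|lborel. c * r n z)"
          by (intro integral_mono integrable_norm int integrable_mult_right int_r bound)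
        then show ?thesis
          by simp
      qed
      then show "summable (\<lambda>n. LINT z|lborel. norm (f z * r n z))"
        using area by (intro summable_comparison_test'[OF summable_mult[OF area, of c]])
    qed
    moreover have "(LINT z|lborel. (\<Sum>n. f z * r n z)) = (LINT z|lborel. f z * D z)"
    proof (rule integral_cong_AE)
      show "AE z in lborel. (\<Sum>n. f z * r n z) = f z * D z"
        using summable by eventually_elim (simp add: D_def suminf_mult)
      show "(\<lambda>z. f z * D z) \<in> borel_measurable lborel"
        using int_D by (intro borel_measurable_times) auto
    qed measurable
    ultimately show ?thesis
      using r_moments[of i j] by (auto simp: f_def intro: sums_unique2)
  qed
  have "AE z in lborel. h z = 0"
  proof (rule AE_eq_0_if_orthogonal_to_monomials[OF _ K(1)])
    show "integrable lborel h"
      unfolding h_def using int_D int_Q by simp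
    show "h z = 0" if "z \<notin> K" for z
      using that K(3) r_outside[OF that] by (auto simp: h_def D_def indicator_def)
    fix i j
    have "integrable lborel (\<lambda>z. fst z ^ i * snd z ^ j * D z)"
      using r_outside
      by (intro integrable_continuous_mult_compact_support[OF int_D K(1)] continuous_intros)
        (simp add: D_def)
    moreover have "integrable lborel (\<lambda>z. fst z ^ i * snd z ^ j * indicat_real Q z)"
      using K(3) by (intro integrable_continuous_mult_compact_support[OF int_Q K(1)] continuous_intros)
        (auto simp: indicator_def)
    ultimately show "(LINT z|lborel. fst z ^ i * snd z ^ j * h z) = 0"
      using D_moments[of i j] by (simp add: h_def right_diff_distrib)
  qed
  then have "AE z in lborel. (\<lambda>n. r n z) sums indicat_real Q z"
    using summable by eventually_elim (simp add: h_def D_def sums_iff)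
  then show ?thesis
    by (simp add: tiles_AE_def sums_over_def r_def)
qed

section \<open>Tilings, packings and the polynomial system\<close>

lemma monomial_integrals_iff_moment_equation:
  assumes "A > 0" "B > 0"
    and sides: "\<And>n. n \<in> N \<Longrightarrow> xm n < xp n" "\<And>n. n \<in> N \<Longrightarrow> ym n < yp n"
  shows "sums_over N (\<lambda>n. LINT z|lborel. fst z ^ i * snd z ^ j *
        indicat_real (rect (xm n) (xp n) (ym n) (yp n)) z)
      (LINT z|lborel. fst z ^ i * snd z ^ j * indicat_real (rect 0 A 0 B) z) \<longleftrightarrow>
    sums_over N (\<lambda>n. (xp n ^ Suc i - xm n ^ Suc i) * (yp n ^ Suc j - ym n ^ Suc j))
      (A ^ Suc i * B ^ Suc j)"
proof -
  define c where "c = inverse (real (Suc i) * real (Suc j))"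
  have "c \<noteq> 0"
    by (simp add: c_def)
  let ?g = "\<lambda>n. (xp n ^ Suc i - xm n ^ Suc i) * (yp n ^ Suc j - ym n ^ Suc j)"
  have integral_rect: "(LINT z|lborel. fst z ^ i * snd z ^ j * indicat_real (rect a b a' b') z) =
      c * ((b ^ Suc i - a ^ Suc i) * (b' ^ Suc j - a' ^ Suc j))" if "a \<le> b" "a' \<le> b'" for a b a' b'
    unfolding integral_monomial_rect[OF that] c_def by (simp only: divide_inverse mult.commute)
  have "(if n \<in> N then LINT z|lborel. fst z ^ i * snd z ^ j *
        indicat_real (rect (xm n) (xp n) (ym n) (yp n)) z else 0) =
      c * (if n \<in> N then ?g n else 0)" for n
    using sides[of n] integral_rect[of "xm n" "xp n" "ym n" "yp n"] by (simp add: less_imp_le)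
  moreover have "(LINT z|lborel. fst z ^ i * snd z ^ j * indicat_real (rect 0 A 0 B) z) =
      c * (A ^ Suc i * B ^ Suc j)"
    using assms(1,2) integral_rect[of 0 A 0 B] by simp
  ultimately show ?thesis
    unfolding sums_over_def using sums_mult_iff[OF \<open>c \<noteq> 0\<close>] by presburger
qed

lemma tiles_AE_iff_moment_equations:
  assumes "A > 0" "B > 0"
    and sides: "\<And>n. n \<in> N \<Longrightarrow> xm n < xp n" "\<And>n. n \<in> N \<Longrightarrow> ym n < yp n"
  shows "tiles_AE N (\<lambda>n. rect (xm n) (xp n) (ym n) (yp n)) (rect 0 A 0 B) \<longleftrightarrow>
    (\<forall>s\<ge>1. \<forall>t\<ge>1.
      sums_over N (\<lambda>n. (xp n ^ s - xm n ^ s) * (yp n ^ t - ym n ^ t)) (A ^ s * B ^ t))"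
    (is "?tiles \<longleftrightarrow> ?eqs")
proof -
  have all_ge_1: "(\<forall>s\<ge>1. P s) \<longleftrightarrow> (\<forall>i. P (Suc i))" for P :: "nat \<Rightarrow> bool"
    by (metis One_nat_def Suc_le_D le_add1 plus_1_eq_Suc)
  have "?eqs \<longleftrightarrow> (\<forall>i j. sums_over N (\<lambda>n. (xp n ^ Suc i - xm n ^ Suc i) * (yp n ^ Suc j - ym n ^ Suc j))
      (A ^ Suc i * B ^ Suc j))"
    by (simp only: all_ge_1)
  also have "\<dots> \<longleftrightarrow> (\<forall>i j. sums_over N (\<lambda>n. LINT z|lborel. fst z ^ i * snd z ^ j *
        indicat_real (rect (xm n) (xp n) (ym n) (yp n)) z)
      (LINT z|lborel. fst z ^ i * snd z ^ j * indicat_real (rect 0 A 0 B) z))"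
    (is "_ \<longleftrightarrow> ?moments")
    by (simp only: monomial_integrals_iff_moment_equation[OF assms])
  finally have moments_iff: "?eqs \<longleftrightarrow> ?moments" .
  have "?tiles \<longleftrightarrow> ?moments"
  proof
    assume ?tiles
    then show ?moments
      by (intro allI tiles_AE_moments[where f="\<lambda>z. fst z ^ _ * snd z ^ _"]
          borel_measurable_continuous_onI continuous_intros sets_rect integrable_monomial_rect)
  next
    assume moments: ?moments
    then have "?eqs"
      by (rule moments_iff[THEN iffD2])
    \<comment> \<open>Back from integrals to powers of the coordinates, whose growth confines the rectangles.\<close>
    then have sub: "rect (xm n) (xp n) (ym n) (yp n) \<subseteq> rect (- A) A (- B) B" if "n \<in> N" for n
      using rect_subset_if_moment_equations[of A B N xm xp ym yp n] assms that by blast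
    have "rect 0 A 0 B \<subseteq> rect (- A) A (- B) B"
      using assms(1,2) by (auto simp: rect_def)
    then show ?tiles
      using moments sub
      by (intro tiles_AE_if_monomial_integrals[OF sets_rect sets_rect compact_rect]) auto
  qed
  then show ?thesis
    by (rule trans) (rule moments_iff[symmetric])
qed

text \<open>Both \<open>{a, b}\<close> and \<open>{c, d}\<close> are the roots of the quadratic with the given sum and product.\<close>

lemma sum_prod_eq_iff:
  fixes a b c d :: "'a::idom"
  shows "a + b = c + d \<and> a * b = c * d \<longleftrightarrow> (a = c \<and> b = d) \<or> (a = d \<and> b = c)"
proof
  assume eqs: "a + b = c + d \<and> a * b = c * d"
  then have "b = c + d - a"
    by (simp add: algebra_simps)
  with eqs have "(a - c) * (a - d) = 0"
    by algebra
  then show "(a = c \<and> b = d) \<or> (a = d \<and> b = c)"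
    using \<open>b = c + d - a\<close> by auto
qed (auto simp: algebra_simps)

theorem theorem1:
  fixes A B :: real and N :: "nat set" and w l :: "nat \<Rightarrow> real"
  assumes "A > 0" and "B > 0"
    and "(\<exists>m\<ge>1. N = {1..m}) \<or> N = {1..}"
    and "\<And>n. n \<in> N \<Longrightarrow> w n > 0"
    and "\<And>n. n \<in> N \<Longrightarrow> l n > 0"
  shows "can_perfectly_pack N w l A B \<longleftrightarrow>
    (\<exists>xm xp ym yp :: nat \<Rightarrow> real.
       (\<forall>S\<^sub>1\<ge>1. \<forall>S\<^sub>2\<ge>1.
          sums_over N (\<lambda>n. (xp n ^ S\<^sub>1 - xm n ^ S\<^sub>1) * (yp n ^ S\<^sub>2 - ym n ^ S\<^sub>2)) (A ^ S\<^sub>1 * B ^ S\<^sub>2)) \<and>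
       (\<forall>n\<in>N. (xp n - xm n) + (yp n - ym n) = w n + l n \<and>
              (xp n - xm n) * (yp n - ym n) = w n * l n))"
proof -
  have orient_iff: "(xp - xm) + (yp - ym) = w n + l n \<and> (xp - xm) * (yp - ym) = w n * l n \<longleftrightarrow>
      (xp = xm + w n \<and> yp = ym + l n) \<or> (xp = xm + l n \<and> yp = ym + w n)" for xm xp ym yp n
    using sum_prod_eq_iff[of "xp - xm" "yp - ym" "w n" "l n"] by (auto simp: algebra_simps)
  have "perfect_packing N w l A B xm xp ym yp \<longleftrightarrow>
      (\<forall>S\<^sub>1\<ge>1. \<forall>S\<^sub>2\<ge>1.
        sums_over N (\<lambda>n. (xp n ^ S\<^sub>1 - xm n ^ S\<^sub>1) * (yp n ^ S\<^sub>2 - ym n ^ S\<^sub>2)) (A ^ S\<^sub>1 * B ^ S\<^sub>2)) \<and>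
      (\<forall>n\<in>N. (xp n - xm n) + (yp n - ym n) = w n + l n \<and> (xp n - xm n) * (yp n - ym n) = w n * l n)"
    (is "?pack \<longleftrightarrow> ?eqs \<and> ?sides") for xm xp ym yp
  proof -
    have orient: "?sides \<longleftrightarrow>
        (\<forall>n\<in>N. (xp n = xm n + w n \<and> yp n = ym n + l n) \<or> (xp n = xm n + l n \<and> yp n = ym n + w n))"
      by (simp only: orient_iff)
    have "?pack \<longleftrightarrow> ?eqs" if ?sides
    proof -
      have sides: "xm n < xp n" "ym n < yp n" if "n \<in> N" for n
        using \<open>?sides\<close> that assms(4,5)[OF that] unfolding orient by auto
      have "?pack \<longleftrightarrow> tiles_AE N (\<lambda>n. rect (xm n) (xp n) (ym n) (yp n)) (rect 0 A 0 B)"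
        using \<open>?sides\<close> assms(4,5) unfolding orient by (intro perfect_packing_iff_tiles_AE) auto
      then show ?thesis
        by (rule trans) (rule tiles_AE_iff_moment_equations[OF assms(1,2) sides])
    qed
    moreover have ?sides if ?pack
      using that unfolding orient perfect_packing_def by (rule conjunct1)
    ultimately show ?thesis
      by argo
  qed
  then show ?thesis
    by (simp only: can_perfectly_pack_def)
qed

end
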